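(* Let $n,m\ge 1$ be integers, let $a,b$ be positive real numbers, and let $\mathbf{F}(n,b)$ and $\mathbf{F}(m,a)$ be the corresponding Fubini-Study spaces. Assume that: (i) there are positive integers $s,r$ such that $sa=rb$; (ii) (for these $s,r$) $m+n+1>\max\left\{\binom{s+m}{s},\binom{r+n}{r}\right\}$. Then $\mathbf{F}(n,b)$ and $\mathbf{F}(m,a)$ are relatives.
   Context: For $b>0$, the Fubini-Study space $\mathbf{F}(n,b)$ is the complex projective space $\mathbb{CP}^n$ with the Kähler metric whose Kähler potential is locally (in suitable affine coordinates $Z=(z_1,\dots,z_n)$) given by $\frac1b\log(1+b|Z|^2)$, where $|Z|^2=\sum_{i=1}^n|z_i|^2$; i.e. the Kähler form is $\sqrt{-1}\,\partial\bar\partial$ of this function. Two Kähler manifolds are called relatives when they share a common positive-dimensional Kähler submanifold, i.e. a positive-dimensional complex submanifold of one of them endowed with the induced metric is biholomorphically isometric to a complex submanifold of the other endowed with the induced metric. *)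

theory Defs
  imports "HOL-Analysis.Analysis"
begin

section \<open>Holomorphic maps between coordinate spaces\<close>

abbreviation complex_linear :: "(complex ^ 'n \<Rightarrow> complex ^ 'm) \<Rightarrow> bool" where
  "complex_linear \<equiv> Vector_Spaces.linear (*s) (*s)"

text \<open>This is applied to sets \<open>X\<close> that are open in a complex linear subspace \<open>V\<close>, possibly the
  whole space. The derivative within \<open>X\<close> is then determined on \<open>V\<close>, and the condition says that
  \<open>f\<close> is complex differentiable on \<open>X\<close> as a map on an open subset of \<open>V\<close>.\<close>

definition holo_on :: "(complex ^ 'n \<Rightarrow> complex ^ 'm) \<Rightarrow> (complex ^ 'n) set \<Rightarrow> bool" where
  "holo_on f X \<longleftrightarrow>
     (\<forall>x\<in>X. \<exists>D. complex_linear D \<and> (f has_derivative D) (at x within X))"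

section \<open>Complex manifolds with a Hermitian metric\<close>

type_synonym ('a, 'n) chart = "'a set \<times> ('a \<Rightarrow> complex ^ 'n)"

text \<open>The record holds the data of a Kaehler manifold of complex dimension \<open>CARD('n)\<close>:
  \<open>hmetric M c z\<close> is the matrix $(h_{jk})$, at the coordinate point \<open>z\<close> of the atlas chart \<open>c\<close>,
  of the Kaehler form $\sqrt{-1} \sum h_{jk} dz_j \wedge d\bar z_k$. The notions below are
  stated for arbitrary such data; the topology is the one defined by the charts.\<close>

record ('a, 'n) kahler_data =
  points :: "'a set"
  atlas :: "('a, 'n) chart set"
  hmetric :: "('a, 'n) chart \<Rightarrow> complex ^ 'n \<Rightarrow> complex ^ 'n ^ 'n"

definition hermitian_form :: "complex ^ 'n ^ 'n \<Rightarrow> complex ^ 'n \<Rightarrow> complex ^ 'n \<Rightarrow> complex" where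
  "hermitian_form H v w = (\<Sum>j\<in>UNIV. \<Sum>k\<in>UNIV. H $ j $ k * v $ j * cnj (w $ k))"

definition maximal_atlas :: "('a, 'n::finite) kahler_data \<Rightarrow> ('a, 'n) chart set" where
  "maximal_atlas M = {(U, \<phi>). U \<subseteq> points M \<and> inj_on \<phi> U \<and> open (\<phi> ` U) \<and>
     (\<forall>(W, \<psi>)\<in>atlas M.
        open (\<phi> ` (U \<inter> W)) \<and> open (\<psi> ` (U \<inter> W)) \<and>
        holo_on (\<psi> \<circ> inv_into U \<phi>) (\<phi> ` (U \<inter> W)) \<and>
        holo_on (\<phi> \<circ> inv_into W \<psi>) (\<psi> ` (U \<inter> W)))}"

section \<open>Complex submanifolds\<close>

definition slice_chart ::
    "('a, 'n::finite) kahler_data \<Rightarrow> 'a set \<Rightarrow> ('a, 'n) chart \<Rightarrow> (complex ^ 'n) set \<Rightarrow> bool" where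
  "slice_chart M S c V \<longleftrightarrow> c \<in> maximal_atlas M \<and> vec.subspace V \<and>
     snd c ` (fst c \<inter> S) = snd c ` fst c \<inter> V"

text \<open>Embedded (not necessarily closed) submanifolds of complex dimension \<open>d\<close>.\<close>

definition complex_submanifold :: "('a, 'n::finite) kahler_data \<Rightarrow> nat \<Rightarrow> 'a set \<Rightarrow> bool" where
  "complex_submanifold M d S \<longleftrightarrow> S \<noteq> {} \<and> S \<subseteq> points M \<and>
     (\<forall>p\<in>S. \<exists>U \<phi> V. p \<in> U \<and> slice_chart M S (U, \<phi>) V \<and> vec.dim V = d)"

text \<open>Holomorphic maps from a submanifold \<open>S\<close> of \<open>M\<close> to a submanifold \<open>T\<close> of \<open>N\<close>. The domain is
  read in slice charts; since \<open>T\<close> is embedded, the target may be read in charts of \<open>N\<close>.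
  Continuity of \<open>F\<close> is part of the condition, through the inclusion of images.\<close>

definition holomorphic_map ::
    "('a, 'n::finite) kahler_data \<Rightarrow> 'a set \<Rightarrow> ('b, 'm::finite) kahler_data \<Rightarrow> 'b set \<Rightarrow> ('a \<Rightarrow> 'b) \<Rightarrow> bool" where
  "holomorphic_map M S N T F \<longleftrightarrow> F ` S \<subseteq> T \<and>
     (\<forall>p\<in>S. \<exists>U \<phi> V W \<psi>. p \<in> U \<and> slice_chart M S (U, \<phi>) V \<and>
        (W, \<psi>) \<in> maximal_atlas N \<and> F ` (U \<inter> S) \<subseteq> W \<and>
        holo_on (\<psi> \<circ> F \<circ> inv_into U \<phi>) (\<phi> ` (U \<inter> S)))"

definition biholomorphic_map ::
    "('a, 'n::finite) kahler_data \<Rightarrow> 'a set \<Rightarrow> ('b, 'm::finite) kahler_data \<Rightarrow> 'b set \<Rightarrow> ('a \<Rightarrow> 'b) \<Rightarrow> bool" where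
  "biholomorphic_map M S N T F \<longleftrightarrow> bij_betw F S T \<and>
     holomorphic_map M S N T F \<and> holomorphic_map N T M S (inv_into S F)"

text \<open>In slice coordinates on \<open>S\<close>, \<open>D\<close> is the differential of the inclusion of \<open>S\<close> in \<open>M\<close>, so the
  left-hand side is the metric induced from \<open>M\<close>; \<open>D'\<close> is the differential of \<open>F\<close>, so the right-hand
  side is the pull-back of the metric that \<open>N\<close> induces on the image of \<open>F\<close>.\<close>

definition preserves_induced_metric ::
    "('a, 'n::finite) kahler_data \<Rightarrow> 'a set \<Rightarrow> ('b, 'm::finite) kahler_data \<Rightarrow> ('a \<Rightarrow> 'b) \<Rightarrow> bool" where
  "preserves_induced_metric M S N F \<longleftrightarrow>
     (\<forall>U \<phi> V W \<psi> W' \<psi>' p D D'.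
        slice_chart M S (U, \<phi>) V \<longrightarrow> (W, \<psi>) \<in> atlas M \<longrightarrow> (W', \<psi>') \<in> atlas N \<longrightarrow>
        p \<in> S \<inter> U \<inter> W \<longrightarrow> F p \<in> W' \<longrightarrow>
        ((\<psi> \<circ> inv_into U \<phi>) has_derivative D) (at (\<phi> p) within \<phi> ` (U \<inter> S)) \<longrightarrow>
        ((\<psi>' \<circ> F \<circ> inv_into U \<phi>) has_derivative D') (at (\<phi> p) within \<phi> ` (U \<inter> S)) \<longrightarrow>
        (\<forall>v\<in>V. \<forall>w\<in>V.
           hermitian_form (hmetric M (W, \<psi>) (\<psi> p)) (D v) (D w) =
           hermitian_form (hmetric N (W', \<psi>') (\<psi>' (F p))) (D' v) (D' w)))"

definition relatives :: "('a, 'n::finite) kahler_data \<Rightarrow> ('b, 'm::finite) kahler_data \<Rightarrow> bool" where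
  "relatives M N \<longleftrightarrow>
     (\<exists>d S T F. d > 0 \<and> complex_submanifold M d S \<and> complex_submanifold N d T \<and>
        biholomorphic_map M S N T F \<and> preserves_induced_metric M S N F)"

section \<open>Kaehler potentials\<close>

definition wirtinger :: "'n::finite \<Rightarrow> (complex ^ 'n \<Rightarrow> complex) \<Rightarrow> complex ^ 'n \<Rightarrow> complex" where
  "wirtinger j f z =
     (frechet_derivative f (at z) (axis j 1) - \<i> * frechet_derivative f (at z) (axis j \<i>)) / 2"

definition wirtinger_bar :: "'n::finite \<Rightarrow> (complex ^ 'n \<Rightarrow> complex) \<Rightarrow> complex ^ 'n \<Rightarrow> complex" where
  "wirtinger_bar j f z =
     (frechet_derivative f (at z) (axis j 1) + \<i> * frechet_derivative f (at z) (axis j \<i>)) / 2"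

text \<open>The coefficient matrix of $\sqrt{-1}\, \partial \bar\partial \Phi$.\<close>

definition complex_hessian :: "(complex ^ 'n \<Rightarrow> real) \<Rightarrow> complex ^ 'n \<Rightarrow> complex ^ 'n ^ 'n" where
  "complex_hessian \<Phi> z =
     (\<chi> j k. wirtinger j (wirtinger_bar k (\<lambda>w. complex_of_real (\<Phi> w))) z)"

section \<open>Fubini-Study spaces\<close>

text \<open>Points of the projective space of dimension \<open>CARD('n)\<close> are lines in the space of homogeneous
  coordinate vectors, indexed by \<open>'n option\<close>.\<close>

type_synonym 'n projective_point = "(complex ^ ('n option)) set"

definition projective_space :: "'n::finite projective_point set" where
  "projective_space = {L. vec.subspace L \<and> vec.dim L = 1}"

definition affine_domain :: "'n::finite option \<Rightarrow> 'n projective_point set" where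
  "affine_domain j = {L \<in> projective_space. \<exists>z\<in>L. z $ j \<noteq> 0}"

text \<open>On the set where the homogeneous coordinate $z_j$ does not vanish, the affine coordinates are
  $z_i / (\sqrt b\, z_j)$ for $i \neq j$. They are numbered by \<open>'n\<close> so that \<open>None\<close> takes the place
  of \<open>j\<close>. With the factor $1 / \sqrt b$ one has $1 + b |Z|^2 = |z|^2 / |z_j|^2$, so that
  the potentials $\frac 1 b \log (1 + b |Z|^2)$ of all these charts define the same Kaehler form.\<close>

definition affine_coords :: "real \<Rightarrow> 'n::finite option \<Rightarrow> 'n projective_point \<Rightarrow> complex ^ 'n" where
  "affine_coords b j L =
     (\<chi> i. (THE z. z \<in> L \<and> z $ j = 1) $ (if j = Some i then None else Some i)
           / complex_of_real (sqrt b))"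

definition fs_potential :: "real \<Rightarrow> complex ^ 'n \<Rightarrow> real" where
  "fs_potential b Z = 1 / b * ln (1 + b * (norm Z)\<^sup>2)"

type_synonym 'n fubini_study_space = "('n projective_point, 'n) kahler_data"

definition fubini_study :: "real \<Rightarrow> 'n::finite fubini_study_space" where
  "fubini_study b =
     \<lparr>points = projective_space,
      atlas = range (\<lambda>j. (affine_domain j, affine_coords b j)),
      hmetric = (\<lambda>_. complex_hessian (fs_potential b))\<rparr>"

end

theory Submission
  imports Defs
begin

text \<open>Since $\binom{s+m}{s} \ge 1 + sm$, condition (ii) forces $s \le n$ and $r \le m$. Put
  $c = b/s = a/r$. The rational normal curve of degree $s$, with coefficients
  $\sqrt{\binom{s}{k} c^k / b}$, satisfies $1 + b|Z(t)|^2 = (1 + c|t|^2)^s$, so that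
  $\frac 1 b \log (1 + b|Z(t)|^2) = \frac 1 c \log (1 + c|t|^2)$. It fits into the first space
  because $s \le n$; the curve of degree $r$ likewise fits into the second one, and the two curves
  are isometric to the projective line of parameter $c$. Their affine parts are graphs
  over a coordinate line, hence embedded submanifolds.\<close>

section \<open>Holomorphic maps\<close>

text \<open>Equality of the potentials along the curves would give equality of the metrics by a
  chain rule for mixed second derivatives. The proof avoids that rule: it evaluates the ambient
  Hermitian form on the velocity vector. With y = c|t|^2 and x = y/(1+y), the value is the variance
  s x (1 - x) of a binomial distribution divided by s y, and the degree s cancels. The other
  obstacle is that \<open>preserves_induced_metric\<close> ranges over all slice charts and all
  pairs of atlas charts, so an isometry in one convenient chart is not enough. Two facts remove the
  choice: the form written in homogeneous coordinates is the same for every affine chart, and a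
  tangent space of a curve is a complex line, so both differentials are a common scalar times a
  fixed velocity.\<close>

lemma has_derivative_vec:
  fixes f :: "'a::real_normed_vector \<Rightarrow> 'b::euclidean_space ^ 'n"
  assumes "\<And>i. ((\<lambda>x. f x $ i) has_derivative (\<lambda>h. D h $ i)) (at x within X)"
  shows "(f has_derivative D) (at x within X)"
  unfolding has_derivative_componentwise_within[of f]
proof
  fix e :: "'b ^ 'n" assume "e \<in> Basis"
  then obtain i u where "e = axis i u"
    by (auto simp: Basis_vec_def)
  then show "((\<lambda>x. f x \<bullet> e) has_derivative (\<lambda>x. D x \<bullet> e)) (at x within X)"
    by (simp add: inner_axis has_derivative_inner_left[OF assms])
qed

lemma has_derivative_vec_nth:
  assumes "(f has_derivative D) (at x within X)"
  shows "((\<lambda>x. f x $ i) has_derivative (\<lambda>h. D h $ i)) (at x within X)"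
  by (rule bounded_linear.has_derivative[OF bounded_linear_vec_nth assms])

lemma has_derivative_vec_nth_at [derivative_intros]:
  "((\<lambda>x. x $ i) has_derivative (\<lambda>h. h $ i)) (at x within X)"
  by (rule has_derivative_vec_nth) (rule has_derivative_ident)

lemma complex_linearI:
  assumes "\<And>x y. D (x + y) = D x + D y" "\<And>c x. D (c *s x) = c *s D x"
  shows "complex_linear D"
  using assms by unfold_locales (simp_all add: vec.scale_right_distrib vec.scale_left_distrib)

lemma holo_on_cong:
  assumes "\<And>x. x \<in> X \<Longrightarrow> f x = g x" "holo_on g X"
  shows "holo_on f X"
  using assms unfolding holo_on_def by (metis has_derivative_transform)

lemma holo_on_subset: "holo_on f X \<Longrightarrow> Y \<subseteq> X \<Longrightarrow> holo_on f Y"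
  unfolding holo_on_def by (meson has_derivative_subset subsetD)

lemma holo_on_compose:
  assumes "holo_on f X" "holo_on g Y" "f ` X \<subseteq> Y"
  shows "holo_on (g \<circ> f) X"
  unfolding holo_on_def
proof
  fix x assume x: "x \<in> X"
  then obtain D where D: "complex_linear D" "(f has_derivative D) (at x within X)"
    using assms(1) unfolding holo_on_def by blast
  obtain E where E: "complex_linear E" "(g has_derivative E) (at (f x) within Y)"
    using assms x unfolding holo_on_def by blast
  have "(g \<circ> f has_derivative E \<circ> D) (at x within X)"
    using diff_chain_within D(2) has_derivative_subset[OF E(2) assms(3)] by blast
  moreover have "complex_linear (E \<circ> D)"
    using D(1) E(1) by (rule Vector_Spaces.linear_compose)
  ultimately show "\<exists>D. complex_linear D \<and> (g \<circ> f has_derivative D) (at x within X)"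
    by blast
qed

lemma holo_on_imp_continuous_on: "holo_on f X \<Longrightarrow> continuous_on X f"
  unfolding holo_on_def
  by (metis continuous_on_eq_continuous_within has_derivative_continuous)

text \<open>The derivative within a relatively open subset of a subspace is determined on that
  subspace only.\<close>

lemma has_derivative_unique_on_subspace:
  fixes f :: "complex ^ 'n \<Rightarrow> complex ^ 'm"
  assumes "open Y" "vec.subspace V" "x \<in> Y \<inter> V" "v \<in> V"
    and D: "(f has_derivative D) (at x within Y \<inter> V)"
    and E: "(f has_derivative E) (at x within Y \<inter> V)"
  shows "D v = E v"
proof -
  \<comment> \<open>Restriction to a real line in a direction of \<open>V\<close> turns
    \<open>D v\<close> into an ordinary vector derivative at 0, which is unique because the preimage
    of the open set \<open>Y\<close> is open.\<close>
  let ?g = "\<lambda>t::real. x + t *\<^sub>R v"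
  have g: "(?g has_derivative (\<lambda>t. t *\<^sub>R v)) (at 0 within ?g -` Y)"
    by (auto intro!: derivative_eq_intros)
  have "t *\<^sub>R v = complex_of_real t *s v" for t
    unfolding vec_eq_iff by (simp add: scaleR_conv_of_real[of _ "v $ _"])
  then have sub: "?g ` (?g -` Y) \<subseteq> Y \<inter> V"
    using assms by (auto intro!: vec.subspace_add vec.subspace_scale)
  have op: "open (?g -` Y)"
    by (rule open_vimage[OF assms(1)]) (intro continuous_intros)
  have "(f \<circ> ?g has_vector_derivative D v) (at 0)"
    if "(f has_derivative D) (at x within Y \<inter> V)" for D
  proof -
    interpret bounded_linear D
      using that by (rule has_derivative_bounded_linear)
    have "(f \<circ> ?g has_derivative D \<circ> (\<lambda>t. t *\<^sub>R v)) (at 0 within ?g -` Y)"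
      by (rule diff_chain_within[OF g]) (use has_derivative_subset[OF that sub] in simp)
    then have "(f \<circ> ?g has_derivative D \<circ> (\<lambda>t. t *\<^sub>R v)) (at 0)"
      using at_within_open[OF _ op, of 0] assms(3) by simp
    then show ?thesis
      by (simp add: has_vector_derivative_def o_def scaleR)
  qed
  from this[OF D] this[OF E] show ?thesis
    by (rule vector_derivative_unique_at)
qed

section \<open>Changing charts\<close>

text \<open>Meant for straightening a curve by a shear of the whole coordinate space. Images under
  \<sigma> are preimages under its continuous inverse \<tau>, hence open.\<close>

lemma maximal_atlas_compose:
  assumes c: "(U, \<phi>) \<in> maximal_atlas M"
    and \<sigma>: "holo_on \<sigma> UNIV" and \<tau>: "holo_on \<tau> UNIV"
    and inv: "\<And>z. \<tau> (\<sigma> z) = z" "\<And>z. \<sigma> (\<tau> z) = z"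
  shows "(U, \<sigma> \<circ> \<phi>) \<in> maximal_atlas M"
proof -
  have inj: "inj_on \<phi> U" and inj': "inj_on (\<sigma> \<circ> \<phi>) U"
    using c inv(1) unfolding maximal_atlas_def inj_on_def by (auto, metis)
  have img: "\<sigma> ` X = \<tau> -` X" for X
    using inv by (auto simp: image_iff) metis
  have op: "open (\<sigma> ` X)" if "open X" for X
    unfolding img using that \<tau> by (auto intro!: open_vimage holo_on_imp_continuous_on)
  have eq: "inv_into U (\<sigma> \<circ> \<phi>) z = inv_into U \<phi> (\<tau> z)" if "z \<in> \<sigma> ` \<phi> ` U" for z
  proof -
    from that obtain p where p: "p \<in> U" "z = \<sigma> (\<phi> p)" by blast
    then have "inv_into U (\<sigma> \<circ> \<phi>) z = p"
      using inv_into_f_f[OF inj' p(1)] by simp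
    then show ?thesis
      using p inv(1) inv_into_f_f[OF inj p(1)] by simp
  qed
  show ?thesis
    unfolding maximal_atlas_def
  proof (clarsimp, intro conjI ballI)
    show "U \<subseteq> points M" using c by (simp add: maximal_atlas_def)
    show "inj_on (\<sigma> \<circ> \<phi>) U" by (fact inj')
    show "open ((\<lambda>x. \<sigma> (\<phi> x)) ` U)"
      using op[of "\<phi> ` U"] c by (simp add: maximal_atlas_def image_image)
    fix d assume d: "d \<in> atlas M"
    obtain W \<psi> where [simp]: "d = (W, \<psi>)" by fastforce
    have *: "open (\<phi> ` (U \<inter> W))" "open (\<psi> ` (U \<inter> W))"
        "holo_on (\<psi> \<circ> inv_into U \<phi>) (\<phi> ` (U \<inter> W))"
        "holo_on (\<phi> \<circ> inv_into W \<psi>) (\<psi> ` (U \<inter> W))"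
      using c d by (auto simp: maximal_atlas_def)
    have 1: "open ((\<lambda>x. \<sigma> (\<phi> x)) ` (U \<inter> W))"
      using op[OF *(1)] by (simp add: image_image)
    have 2: "holo_on (\<sigma> \<circ> \<phi> \<circ> inv_into W \<psi>) (\<psi> ` (U \<inter> W))"
      using holo_on_compose[OF *(4) \<sigma>] by (simp add: o_assoc)
    have "holo_on ((\<psi> \<circ> inv_into U \<phi>) \<circ> \<tau>) ((\<lambda>x. \<sigma> (\<phi> x)) ` (U \<inter> W))"
      by (rule holo_on_compose[OF holo_on_subset[OF \<tau>] *(3)]) (auto simp: inv)
    then have 3: "holo_on (\<psi> \<circ> inv_into U (\<sigma> \<circ> \<phi>)) ((\<lambda>x. \<sigma> (\<phi> x)) ` (U \<inter> W))"
      by (rule holo_on_cong[rotated]) (auto simp: eq)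
    show "case d of (W, \<psi>) \<Rightarrow>
        open ((\<lambda>x. \<sigma> (\<phi> x)) ` (U \<inter> W)) \<and>
        open (\<psi> ` (U \<inter> W)) \<and>
        holo_on (\<psi> \<circ> inv_into U (\<sigma> \<circ> \<phi>)) ((\<lambda>x. \<sigma> (\<phi> x)) ` (U \<inter> W)) \<and>
        holo_on (\<sigma> \<circ> \<phi> \<circ> inv_into W \<psi>) (\<psi> ` (U \<inter> W))"
      using 1 2 3 *(2) by simp
  qed
qed

section \<open>Affine charts of projective space\<close>

text \<open>\<open>slot j i\<close> is the homogeneous coordinate whose quotient by the \<open>j\<close>-th one is the \<open>i\<close>-th affine
  coordinate.\<close>

definition slot :: "'n option \<Rightarrow> 'n \<Rightarrow> 'n option" where
  "slot j i = (if j = Some i then None else Some i)"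

text \<open>The representative of a line whose entry \<open>j\<close> is 1; \<open>sqrt b\<close>
  undoes the scaling in \<open>affine_coords\<close>. If \<open>l\<close> is \<open>None\<close> and
  differs from \<open>j\<close>, the index is \<open>the j\<close>, since \<open>slot j\<close>
  sends that index to \<open>None\<close>.\<close>

definition homog :: "real \<Rightarrow> 'n option \<Rightarrow> complex ^ 'n::finite \<Rightarrow> complex ^ 'n option" where
  "homog b j z = (\<chi> l. if l = j then 1
     else complex_of_real (sqrt b) * z $ (case l of None \<Rightarrow> the j | Some i \<Rightarrow> i))"

lemma bij_betw_slot: "bij_betw (slot j) UNIV (- {j})"
proof -
  have "l \<in> range (slot j)" if "l \<noteq> j" for l
    using that by (cases l; cases j) (auto simp: slot_def image_iff)
  then show ?thesis
    by (auto simp: bij_betw_def inj_on_def slot_def split: if_splits)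
qed

lemma homog_self [simp]: "homog b j z $ j = 1"
  by (simp add: homog_def)

lemma homog_slot [simp]: "homog b j z $ slot j i = complex_of_real (sqrt b) * z $ i"
  by (auto simp: homog_def slot_def)

lemma span_in_projective_space: "\<zeta> \<noteq> 0 \<Longrightarrow> vec.span {\<zeta>} \<in> projective_space"
  by (simp add: projective_space_def vec.dim_span_eq_card_independent
      vec.independent_insert[of \<zeta> "{}"])

lemma affine_domain_span: "\<zeta> $ j \<noteq> 0 \<Longrightarrow> vec.span {\<zeta>} \<in> affine_domain j"
  using vec.span_base[of \<zeta> "{\<zeta>}"]
  by (auto simp: affine_domain_def intro!: span_in_projective_space)

lemma span_in_affine_domain_iff: "vec.span {\<zeta>} \<in> affine_domain j \<longleftrightarrow> \<zeta> $ j \<noteq> 0"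
  using affine_domain_span by (auto simp: affine_domain_def vec.span_singleton)

lemma affine_coords_span:
  assumes "\<zeta> $ j \<noteq> 0"
  shows "affine_coords b j (vec.span {\<zeta>}) $ i
    = \<zeta> $ slot j i / (complex_of_real (sqrt b) * \<zeta> $ j)"
proof -
  have "(THE z. z \<in> vec.span {\<zeta>} \<and> z $ j = 1) = inverse (\<zeta> $ j) *s \<zeta>"
    using assms by (intro the_equality) (auto simp: vec.span_singleton field_simps)
  then show ?thesis
    by (simp add: affine_coords_def slot_def divide_simps)
qed

lemma span_homog_affine_coords:
  assumes "0 < b" "L \<in> affine_domain j"
  shows "vec.span {homog b j (affine_coords b j L)} = L"
proof -
  obtain z where L: "vec.subspace L" "vec.dim L = 1" and z: "z \<in> L" "z $ j \<noteq> 0"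
    using assms(2) by (auto simp: affine_domain_def projective_space_def)
  have "z \<noteq> 0" using z(2) by auto
  then have span: "L = vec.span {z}"
    using L z(1) vec.card_ge_dim_independent[of "{z}" L] vec.span_minimal[of "{z}" L]
    by (simp add: vec.independent_insert[of z "{}"] subset_antisym)
  have l: "homog b j (affine_coords b j L) $ l = inverse (z $ j) * z $ l" for l
  proof (cases "l = j")
    case False
    then obtain i where i: "l = slot j i"
      using bij_betw_slot[of j] by (auto simp: bij_betw_def)
    show ?thesis
      unfolding i homog_slot span using assms(1) z(2) by (simp add: affine_coords_span divide_simps)
  qed (use z in simp)
  then have h: "homog b j (affine_coords b j L) = inverse (z $ j) *s z"
    by (simp add: vec_eq_iff)
  have "range (\<lambda>c. c *s (inverse (z $ j) *s z)) = range (\<lambda>c. c *s z)"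
  proof (intro equalityI subsetI)
    fix x assume "x \<in> range (\<lambda>c. c *s z)"
    then obtain c where "x = c *s z" by blast
    then show "x \<in> range (\<lambda>c. c *s (inverse (z $ j) *s z))"
      using z(2) by (intro image_eqI[of _ _ "c * z $ j"]) simp_all
  qed auto
  then have "vec.span {inverse (z $ j) *s z} = vec.span {z}"
    by (simp only: vec.span_singleton)
  then show ?thesis
    by (simp only: h span[symmetric])
qed

lemma affine_coords_span_homog:
  assumes "0 < b"
  shows "affine_coords b j (vec.span {homog b j z}) = z"
  using assms by (simp add: vec_eq_iff affine_coords_span)

lemma inj_on_affine_coords: "0 < b \<Longrightarrow> inj_on (affine_coords b j) (affine_domain j)"
  by (metis inj_onI span_homog_affine_coords)

lemma affine_coords_image:
  assumes "0 < b"
  shows "affine_coords b j ` (affine_domain j \<inter> affine_domain k) = {z. homog b j z $ k \<noteq> 0}"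
proof (intro equalityI subsetI)
  fix z assume "z \<in> {z. homog b j z $ k \<noteq> 0}"
  then show "z \<in> affine_coords b j ` (affine_domain j \<inter> affine_domain k)"
    using affine_coords_span_homog[OF assms, of j z]
    by (intro image_eqI[of _ _ "vec.span {homog b j z}"]) (simp_all add: span_in_affine_domain_iff)
qed (use assms in \<open>auto simp: span_homog_affine_coords
      span_in_affine_domain_iff[of "homog b j z" for z, symmetric]\<close>)

lemma inv_into_affine_coords:
  assumes "0 < b"
  shows "inv_into (affine_domain j) (affine_coords b j) z = vec.span {homog b j z}"
  by (rule inv_into_f_eq[OF inj_on_affine_coords[OF assms]])
    (simp_all add: affine_coords_span_homog assms span_in_affine_domain_iff)

text \<open>\<open>homog b j\<close> is affine with constant part only in entry \<open>j\<close>, so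
  its linear part is its differential at every point.\<close>

definition homog_deriv :: "real \<Rightarrow> 'n option \<Rightarrow> complex ^ 'n::finite \<Rightarrow> complex ^ 'n option" where
  "homog_deriv b j z = (\<chi> l. if l = j then 0 else homog b j z $ l)"

lemma has_derivative_homog:
  "((\<lambda>z. homog b j z $ l) has_derivative (\<lambda>h. homog_deriv b j h $ l)) (at z within X)"
proof (cases "l = j")
  case False
  then show ?thesis
    by (auto simp: homog_def homog_deriv_def intro!: derivative_eq_intros)
qed (simp add: homog_deriv_def)

lemma homog_deriv_add: "homog_deriv b j (x + y) = homog_deriv b j x + homog_deriv b j y"
  by (simp add: homog_deriv_def homog_def vec_eq_iff algebra_simps)

lemma homog_deriv_scale: "homog_deriv b j (c *s x) = c *s homog_deriv b j x"
  by (simp add: homog_deriv_def homog_def vec_eq_iff algebra_simps)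

lemma holo_on_affine_transition:
  fixes j k :: "'n::finite option"
  assumes "0 < b"
  shows "holo_on (affine_coords b k \<circ> inv_into (affine_domain j) (affine_coords b j))
    {z. homog b j z $ k \<noteq> 0}"
  unfolding holo_on_def
proof (intro ballI exI conjI)
  fix z :: "complex ^ 'n" assume "z \<in> {z. homog b j z $ k \<noteq> 0}"
  then have z: "homog b j z $ k \<noteq> 0" by simp
  \<comment> \<open>Quotient rule for the ratio of affine functions given by
    \<open>affine_coords_span\<close>.\<close>
  let ?D = "\<lambda>h. \<chi> i. (homog_deriv b j h $ slot k i * homog b j z $ k
      - homog b j z $ slot k i * homog_deriv b j h $ k)
      / (complex_of_real (sqrt b) * (homog b j z $ k)\<^sup>2)"
  show "complex_linear ?D"
    by (rule complex_linearI)
      (simp_all add: vec_eq_iff homog_deriv_add homog_deriv_scale diff_divide_distrib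
        add_divide_distrib algebra_simps)
  show "((affine_coords b k \<circ> inv_into (affine_domain j) (affine_coords b j)) has_derivative ?D)
      (at z within {z. homog b j z $ k \<noteq> 0})"
  proof (rule has_derivative_vec)
    fix i
    have "((\<lambda>z. homog b j z $ slot k i / (complex_of_real (sqrt b) * homog b j z $ k))
        has_derivative (\<lambda>h. ?D h $ i)) (at z within {z. homog b j z $ k \<noteq> 0})"
      using z assms
      by (auto intro!: derivative_eq_intros has_derivative_homog simp: field_simps power2_eq_square)
    then show "((\<lambda>z. (affine_coords b k \<circ> inv_into (affine_domain j) (affine_coords b j)) z $ i)
        has_derivative (\<lambda>h. ?D h $ i)) (at z within {z. homog b j z $ k \<noteq> 0})"
      by (rule has_derivative_transform[rotated 2])
        (use z in \<open>auto simp: inv_into_affine_coords[OF assms] affine_coords_span\<close>)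
  qed
qed

lemma open_affine_overlap: "open {z. homog b j z $ k \<noteq> 0}"
proof -
  have "continuous_on UNIV (\<lambda>z. homog b j z $ k)"
    unfolding continuous_on_eq_continuous_within
    using has_derivative_continuous[OF has_derivative_homog] by blast
  then have "open ((\<lambda>z. homog b j z $ k) -` (- {0}))"
    by (intro open_vimage) auto
  then show ?thesis
    by (simp add: vimage_def)
qed

lemma affine_chart_in_maximal_atlas:
  assumes "0 < b"
  shows "(affine_domain j, affine_coords b j) \<in> maximal_atlas (fubini_study b)"
proof -
  have 1: "affine_coords b j ` affine_domain j = UNIV"
    using affine_coords_image[OF assms, of j j] by simp
  have 2: "affine_domain k \<subseteq> projective_space" for k :: "'a option"
    by (auto simp: affine_domain_def)
  have 3: "affine_coords b k ` (affine_domain j \<inter> affine_domain k) = {z. homog b k z $ j \<noteq> 0}" for k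
    using affine_coords_image[OF assms, of k j] by (simp add: Int_commute)
  show ?thesis
    using assms 1 2[of j]
    by (simp add: maximal_atlas_def fubini_study_def affine_coords_image 3
        inj_on_affine_coords open_affine_overlap holo_on_affine_transition)
qed

section \<open>The Fubini-Study metric\<close>

lemma has_derivative_fs_potential:
  assumes "0 < b"
  shows "((\<lambda>w. complex_of_real (fs_potential b w)) has_derivative
    (\<lambda>h. complex_of_real (2 * (z \<bullet> h) / (1 + b * (norm z)\<^sup>2)))) (at z)"
proof -
  have "0 < 1 + b * (z \<bullet> z)"
    using assms by (simp add: add_pos_nonneg)
  then show ?thesis
    unfolding fs_potential_def power2_norm_eq_inner using assms
    by (auto intro!: derivative_eq_intros simp: inner_commute divide_simps)
qed

lemma frechet_derivative_eq:
  "(f has_derivative D) (at z) \<Longrightarrow> frechet_derivative f (at z) = D"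
  by (rule frechet_derivative_at[symmetric])

lemma wirtinger_bar_fs_potential:
  assumes "0 < b"
  shows "wirtinger_bar k (\<lambda>w. complex_of_real (fs_potential b w)) z
    = z $ k / complex_of_real (1 + b * (norm z)\<^sup>2)"
proof -
  have "(complex_of_real (2 * x / q) + \<i> * complex_of_real (2 * y / q)) / 2
      = Complex x y / complex_of_real q" for x y q
    by (simp add: Complex_eq add_divide_distrib)
  from this[of "Re (z $ k)" "1 + b * (norm z)\<^sup>2" "Im (z $ k)"] show ?thesis
    by (simp add: wirtinger_bar_def frechet_derivative_eq[OF has_derivative_fs_potential[OF assms]]
        inner_axis inner_complex_def del: of_real_add of_real_mult of_real_divide)
qed

lemma complex_hessian_fs_potential:
  assumes "0 < b"
  defines "Q z \<equiv> complex_of_real (1 + b * (norm z)\<^sup>2)"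
  shows "complex_hessian (fs_potential b) z $ j $ k
    = (if j = k then 1 else 0) / Q z - complex_of_real b * cnj (z $ j) * z $ k / (Q z)\<^sup>2"
proof -
  have "0 < 1 + b * (z \<bullet> z)"
    using assms by (simp add: add_pos_nonneg)
  then have Q: "Q z \<noteq> 0"
    by (simp add: Q_def power2_norm_eq_inner del: of_real_add)
  have "((\<lambda>z. z $ k / Q z) has_derivative
      (\<lambda>h. (h $ k * Q z - z $ k * complex_of_real (2 * b * (z \<bullet> h))) / (Q z)\<^sup>2)) (at z)"
    using Q unfolding Q_def power2_norm_eq_inner
    by (auto intro!: derivative_eq_intros simp: inner_commute power2_eq_square)
  note D = frechet_derivative_eq[OF this]
  \<comment> \<open>The inner products of \<open>z\<close> with the directions 1 and \<i> on axis
    \<open>j\<close> are the real and imaginary parts of its entry; \<open>wirtinger\<close>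
    combines them into the conjugate.\<close>
  have cnj: "cnj (z $ j) = complex_of_real (Re (z $ j)) - \<i> * complex_of_real (Im (z $ j))"
    by (simp add: complex_eq_iff)
  have ax: "axis j x $ k = (if j = k then x else 0)" for x :: complex
    by (simp add: axis_def)
  show ?thesis
    using Q unfolding complex_hessian_def wirtinger_bar_fs_potential[OF assms(1)] Q_def[symmetric]
    by (simp add: wirtinger_def D inner_axis inner_complex_def cnj ax power2_eq_square
        field_simps)
qed

text \<open>The second summand of the Hessian has rank one, so its double sum factors into two
  pairings with \<open>z\<close>.\<close>

lemma hermitian_form_fs_potential:
  assumes "0 < b"
  defines "Q z \<equiv> complex_of_real (1 + b * (norm z)\<^sup>2)"
  shows "hermitian_form (complex_hessian (fs_potential b) z) v w
    = (\<Sum>j\<in>UNIV. v $ j * cnj (w $ j)) / Q z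
      - complex_of_real b * (\<Sum>j\<in>UNIV. v $ j * cnj (z $ j)) * (\<Sum>k\<in>UNIV. z $ k * cnj (w $ k))
        / (Q z)\<^sup>2"
proof -
  have "hermitian_form (complex_hessian (fs_potential b) z) v w
      = (\<Sum>j\<in>UNIV. \<Sum>k\<in>UNIV. (if j = k then v $ j * cnj (w $ j) / Q z else 0)
          - complex_of_real b / (Q z)\<^sup>2 * ((v $ j * cnj (z $ j)) * (z $ k * cnj (w $ k))))"
    unfolding hermitian_form_def
    by (intro sum.cong refl)
      (simp add: complex_hessian_fs_potential[OF assms(1)] Q_def algebra_simps)
  also have "\<dots> = (\<Sum>j\<in>UNIV. v $ j * cnj (w $ j) / Q z)
      - complex_of_real b / (Q z)\<^sup>2
        * ((\<Sum>j\<in>UNIV. v $ j * cnj (z $ j)) * (\<Sum>k\<in>UNIV. z $ k * cnj (w $ k)))"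
    by (simp add: sum_subtractf sum_product)
      (simp add: sum_distrib_left sum_divide_distrib)
  finally show ?thesis
    by (simp add: sum_divide_distrib)
qed

text \<open>Since a tangent space of a curve is a complex line, one value on a velocity vector
  determines the induced metric on all pairs.\<close>

lemma hermitian_form_rank_one:
  "hermitian_form H (x *s v) (y *s v) = x * cnj y * hermitian_form H v v"
  by (simp add: hermitian_form_def sum_distrib_left algebra_simps)

text \<open>In homogeneous coordinates the metric is $|\zeta \wedge d\zeta|^2 / (b |\zeta|^4)$, which does not
  change when \<open>\<zeta>\<close> is rescaled by a function and hence does not depend on the chart.\<close>

lemma hermitian_form_homogeneous:
  fixes \<zeta> \<zeta>' :: "complex ^ 'n::finite option"
  assumes b: "0 < b" and j: "\<zeta> $ j \<noteq> 0"
  defines "g \<equiv> \<chi> i. \<zeta> $ slot j i / (complex_of_real (sqrt b) * \<zeta> $ j)"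
    and "g' \<equiv> \<chi> i. (\<zeta>' $ slot j i * \<zeta> $ j - \<zeta> $ slot j i * \<zeta>' $ j)
        / (complex_of_real (sqrt b) * (\<zeta> $ j)\<^sup>2)"
    and "Z \<equiv> \<Sum>l\<in>UNIV. \<zeta> $ l * cnj (\<zeta> $ l)"
    and "A \<equiv> \<Sum>l\<in>UNIV. \<zeta>' $ l * cnj (\<zeta>' $ l)"
    and "C \<equiv> \<Sum>l\<in>UNIV. \<zeta>' $ l * cnj (\<zeta> $ l)"
  shows "hermitian_form (complex_hessian (fs_potential b) g) g' g'
    = (A * Z - C * cnj C) / (complex_of_real b * Z\<^sup>2)"
proof -
  define x y where "x = \<zeta> $ j" and "y = \<zeta>' $ j"
  have x: "x \<noteq> 0" using j by (simp add: x_def)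
  have sq: "complex_of_real (sqrt b) * complex_of_real (sqrt b) = complex_of_real b"
    using b by (simp flip: of_real_mult)
  have b0: "complex_of_real (sqrt b) \<noteq> 0" "complex_of_real b \<noteq> 0"
    using b by simp_all
  have slot: "(\<Sum>i\<in>UNIV. f (slot j i)) = (\<Sum>l\<in>UNIV. f l) - f j" for f :: "'n option \<Rightarrow> complex"
    using sum.reindex_bij_betw[OF bij_betw_slot, of f j]
    by (simp add: Compl_eq_Diff_UNIV sum_diff1)
  have cnjC: "cnj C = (\<Sum>l\<in>UNIV. \<zeta> $ l * cnj (\<zeta>' $ l))"
    by (simp add: C_def mult.commute)
  have "Z = complex_of_real (\<Sum>l\<in>UNIV. (norm (\<zeta> $ l))\<^sup>2)"
    by (simp add: Z_def complex_norm_square[symmetric])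
  moreover have "0 < (\<Sum>l\<in>UNIV. (norm (\<zeta> $ l))\<^sup>2)"
    using j by (intro sum_pos2[of _ j]) auto
  ultimately have Z: "Z \<noteq> 0"
    by (metis less_irrefl of_real_eq_0_iff)
  have "(norm g)\<^sup>2 = (\<Sum>i\<in>UNIV. (norm (g $ i))\<^sup>2)"
    by (simp add: norm_vec_def L2_set_def sum_nonneg)
  then have "complex_of_real ((norm g)\<^sup>2) = (\<Sum>i\<in>UNIV. g $ i * cnj (g $ i))"
    by (simp only: of_real_sum complex_norm_square)
  also have "\<dots> = (\<Sum>i\<in>UNIV. \<zeta> $ slot j i * cnj (\<zeta> $ slot j i) / (complex_of_real b * x * cnj x))"
    by (simp add: g_def x_def ac_simps flip: sq)
  also have "\<dots> = (Z - x * cnj x) / (complex_of_real b * x * cnj x)"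
    using slot[of "\<lambda>l. \<zeta> $ l * cnj (\<zeta> $ l) / (complex_of_real b * x * cnj x)"]
    by (simp add: Z_def x_def diff_divide_distrib sum_divide_distrib)
  finally have Q: "complex_of_real (1 + b * (norm g)\<^sup>2) = Z / (x * cnj x)"
    using x b0 by (simp add: field_simps)
  \<comment> \<open>The numerator vanishes at \<open>l = j\<close>, so the sum over the slots, which
    omit \<open>j\<close>, equals the full sum; the same holds for \<open>h\<close> below.\<close>
  define f where "f l = (\<zeta>' $ l * x - \<zeta> $ l * y) * cnj (\<zeta>' $ l * x - \<zeta> $ l * y)
      / (complex_of_real b * x\<^sup>2 * (cnj x)\<^sup>2)" for l
  have "(\<Sum>i\<in>UNIV. g' $ i * cnj (g' $ i))
      = (\<Sum>i\<in>UNIV. f (slot j i))"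
    unfolding f_def
    by (simp add: g'_def x_def y_def ac_simps flip: sq)
  also have "\<dots> = (\<Sum>l\<in>UNIV. (\<zeta>' $ l * x - \<zeta> $ l * y) * cnj (\<zeta>' $ l * x - \<zeta> $ l * y))
      / (complex_of_real b * x\<^sup>2 * (cnj x)\<^sup>2)"
    unfolding slot by (simp add: f_def x_def y_def sum_divide_distrib mult.commute)
  also have "(\<Sum>l\<in>UNIV. (\<zeta>' $ l * x - \<zeta> $ l * y) * cnj (\<zeta>' $ l * x - \<zeta> $ l * y))
      = A * (x * cnj x) - C * (x * cnj y) - cnj C * (y * cnj x) + Z * (y * cnj y)"
    unfolding A_def cnjC Z_def unfolding C_def
    by (simp add: algebra_simps sum.distrib sum_subtractf) (simp add: sum_distrib_left ac_simps)
  finally have N: "(\<Sum>i\<in>UNIV. g' $ i * cnj (g' $ i))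
      = (A * (x * cnj x) - C * (x * cnj y) - cnj C * (y * cnj x) + Z * (y * cnj y))
        / (complex_of_real b * x\<^sup>2 * (cnj x)\<^sup>2)" .
  define h where "h l = (\<zeta>' $ l * x - \<zeta> $ l * y) * cnj (\<zeta> $ l)
      / (complex_of_real b * x\<^sup>2 * cnj x)" for l
  have "(\<Sum>i\<in>UNIV. g' $ i * cnj (g $ i))
      = (\<Sum>i\<in>UNIV. h (slot j i))"
    unfolding h_def
    by (simp add: g_def g'_def x_def y_def ac_simps flip: sq)
  also have "\<dots> = (\<Sum>l\<in>UNIV. (\<zeta>' $ l * x - \<zeta> $ l * y) * cnj (\<zeta> $ l))
      / (complex_of_real b * x\<^sup>2 * cnj x)"
    unfolding slot by (simp add: h_def x_def y_def sum_divide_distrib mult.commute)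
  also have "(\<Sum>l\<in>UNIV. (\<zeta>' $ l * x - \<zeta> $ l * y) * cnj (\<zeta> $ l)) = C * x - Z * y"
    unfolding C_def Z_def
    by (simp add: algebra_simps sum_subtractf) (simp add: sum_distrib_left)
  finally have P: "(\<Sum>i\<in>UNIV. g' $ i * cnj (g $ i)) = (C * x - Z * y)
      / (complex_of_real b * x\<^sup>2 * cnj x)" .
  have "(\<Sum>i\<in>UNIV. g $ i * cnj (g' $ i)) = cnj (\<Sum>i\<in>UNIV. g' $ i * cnj (g $ i))"
    by (simp add: mult.commute)
  also have "\<dots> = (cnj C * cnj x - Z * cnj y) / (complex_of_real b * (cnj x)\<^sup>2 * x)"
    unfolding P by (simp add: Z_def mult.commute)
  finally have P': "(\<Sum>i\<in>UNIV. g $ i * cnj (g' $ i))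
      = (cnj C * cnj x - Z * cnj y) / (complex_of_real b * (cnj x)\<^sup>2 * x)" .
  have cx: "cnj x \<noteq> 0" using x by simp
  \<comment> \<open>\<open>X\<close>, \<open>Y\<close>, \<open>D\<close> stand for the conjugates of
    \<open>x\<close>, \<open>y\<close>, \<open>C\<close>. All terms with \<open>y\<close> or
    \<open>Y\<close> cancel: this is the invariance under rescaling.\<close>
  have alg: "(A * (x * X) - C * (x * Y) - D * (y * X) + Z * (y * Y)) / (B * x\<^sup>2 * X\<^sup>2) / (Z / (x * X))
      - B * ((C * x - Z * y) / (B * x\<^sup>2 * X)) * ((D * X - Z * Y) / (B * X\<^sup>2 * x)) / (Z / (x * X))\<^sup>2
      = (A * Z - C * D) / (B * Z\<^sup>2)"
    if "B \<noteq> 0" "X \<noteq> 0" for B D X Y :: complex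
    using that x Z by (simp add: field_simps power2_eq_square)
  show ?thesis
    unfolding hermitian_form_fs_potential[OF b] Q N P P' by (rule alg[OF b0(2) cx])
qed

section \<open>Graphs of entire curves as submanifolds\<close>

text \<open>Taking coordinate \<open>i0\<close> as the parameter makes the curve injective with
  nonzero velocity, and a shear straightens it without an inverse function theorem.\<close>

definition graph_curve :: "'n::finite \<Rightarrow> (complex \<Rightarrow> complex ^ 'n) \<Rightarrow> (complex \<Rightarrow> complex ^ 'n) \<Rightarrow> bool" where
  "graph_curve i0 \<alpha> \<alpha>' \<longleftrightarrow> (\<forall>t. \<alpha> t $ i0 = t) \<and>
     (\<forall>t i. ((\<lambda>t. \<alpha> t $ i) has_field_derivative \<alpha>' t $ i) (at t))"

definition curve_point :: "real \<Rightarrow> (complex \<Rightarrow> complex ^ 'n::finite) \<Rightarrow> complex \<Rightarrow> 'n projective_point" where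
  "curve_point b \<alpha> t = vec.span {homog b None (\<alpha> t)}"

definition curve_chart ::
    "real \<Rightarrow> 'n::finite \<Rightarrow> (complex \<Rightarrow> complex ^ 'n) \<Rightarrow> 'n projective_point \<Rightarrow> complex ^ 'n" where
  "curve_chart b i0 \<alpha> =
     (\<lambda>z. \<chi> i. if i = i0 then z $ i else z $ i - \<alpha> (z $ i0) $ i) \<circ> affine_coords b None"

lemma affine_coords_curve_point [simp]:
  "0 < b \<Longrightarrow> affine_coords b None (curve_point b \<alpha> t) = \<alpha> t"
  by (simp add: curve_point_def affine_coords_span_homog)

lemma curve_point_in_affine_domain_iff:
  "curve_point b \<alpha> t \<in> affine_domain j \<longleftrightarrow> homog b None (\<alpha> t) $ j \<noteq> 0"
  by (simp add: curve_point_def span_in_affine_domain_iff)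

lemma curve_point_in_affine_domain [simp]: "curve_point b \<alpha> t \<in> affine_domain None"
  by (simp add: curve_point_in_affine_domain_iff)

lemma curve_chart_curve_point:
  assumes "0 < b" "graph_curve i0 \<alpha> \<alpha>'"
  shows "curve_chart b i0 \<alpha> (curve_point b \<alpha> t) = axis i0 t"
  using assms by (simp add: curve_chart_def graph_curve_def axis_def vec_eq_iff)

text \<open>\<open>c = -1\<close> gives the straightening map and \<open>c = 1\<close> its inverse:
  entry \<open>i0\<close> is kept, so the subtracted vector can be recovered.\<close>

lemma holo_on_shear:
  assumes "graph_curve i0 \<alpha> \<alpha>'"
  shows "holo_on (\<lambda>z. \<chi> i. if i = i0 then z $ i else z $ i + c * \<alpha> (z $ i0) $ i) X"
  unfolding holo_on_def
proof (intro ballI exI conjI)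
  fix z
  let ?D = "\<lambda>h. \<chi> i. if i = i0 then h $ i else h $ i + c * (\<alpha>' (z $ i0) $ i * h $ i0)"
  show "complex_linear ?D"
    by (rule complex_linearI) (simp_all add: vec_eq_iff algebra_simps)
  have \<alpha>: "((\<lambda>t. \<alpha> t $ i) has_derivative (\<lambda>h. \<alpha>' (z $ i0) $ i * h)) (at (z $ i0))" for i
    using assms by (simp add: graph_curve_def has_field_derivative_def)
  show "((\<lambda>z. \<chi> i. if i = i0 then z $ i else z $ i + c * \<alpha> (z $ i0) $ i) has_derivative ?D)
      (at z within X)"
  proof (rule has_derivative_vec)
    fix i
    have "((\<lambda>z. \<alpha> (z $ i0) $ i) has_derivative (\<lambda>h. \<alpha>' (z $ i0) $ i * h $ i0)) (at z within X)"
      by (rule has_derivative_compose[OF has_derivative_vec_nth_at \<alpha>])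
    then show "((\<lambda>z. (\<chi> i. if i = i0 then z $ i else z $ i + c * \<alpha> (z $ i0) $ i) $ i)
        has_derivative (\<lambda>h. ?D h $ i)) (at z within X)"
      by (cases "i = i0") (auto intro!: derivative_eq_intros)
  qed
qed

lemma curve_chart_in_maximal_atlas:
  assumes "0 < b" "graph_curve i0 \<alpha> \<alpha>'"
  shows "(affine_domain None, curve_chart b i0 \<alpha>) \<in> maximal_atlas (fubini_study b)"
  unfolding curve_chart_def
proof (rule maximal_atlas_compose[OF affine_chart_in_maximal_atlas[OF assms(1)],
      where \<tau> = "\<lambda>z. \<chi> i. if i = i0 then z $ i else z $ i + \<alpha> (z $ i0) $ i"])
  show "holo_on (\<lambda>z. \<chi> i. if i = i0 then z $ i else z $ i - \<alpha> (z $ i0) $ i) UNIV"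
    using holo_on_shear[OF assms(2), of "-1" UNIV] by (simp cong: if_cong)
  show "holo_on (\<lambda>z. \<chi> i. if i = i0 then z $ i else z $ i + \<alpha> (z $ i0) $ i) UNIV"
    using holo_on_shear[OF assms(2), of 1 UNIV] by (simp cong: if_cong)
qed (simp_all add: vec_eq_iff)

lemma curve_chart_image:
  assumes "0 < b" "graph_curve i0 \<alpha> \<alpha>'"
  shows "curve_chart b i0 \<alpha> ` (affine_domain None \<inter> range (curve_point b \<alpha>)) = range (axis i0)"
proof -
  have "affine_domain None \<inter> range (curve_point b \<alpha>) = range (curve_point b \<alpha>)"
    by auto
  then show ?thesis
    by (simp add: image_image curve_chart_curve_point[OF assms])
qed

lemma range_axis: "range (axis i0) = vec.span {axis i0 (1::complex)}"
proof -
  have "axis i0 = (\<lambda>t::complex. t *s axis i0 1)"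
    by (simp add: fun_eq_iff vec_eq_iff axis_def)
  then show ?thesis
    unfolding vec.span_singleton by (rule arg_cong)
qed

lemma slice_chart_curve:
  assumes "0 < b" "graph_curve i0 \<alpha> \<alpha>'"
  shows "slice_chart (fubini_study b) (range (curve_point b \<alpha>))
    (affine_domain None, curve_chart b i0 \<alpha>) (range (axis i0))"
proof -
  have "range (axis i0) \<subseteq> curve_chart b i0 \<alpha> ` affine_domain None"
    using curve_chart_image[OF assms] by blast
  then show ?thesis
    using curve_chart_image[OF assms] curve_chart_in_maximal_atlas[OF assms]
    by (auto simp: slice_chart_def range_axis)
qed

lemma complex_submanifold_curve:
  assumes "0 < b" "graph_curve i0 \<alpha> \<alpha>'"
  shows "complex_submanifold (fubini_study b) 1 (range (curve_point b \<alpha>))"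
proof -
  have "axis i0 (1::complex) \<noteq> 0"
    by (simp add: axis_eq_0_iff)
  then have "vec.dim (range (axis i0 :: complex \<Rightarrow> _)) = 1"
    by (simp add: range_axis vec.dim_span_eq_card_independent
        vec.independent_insert[of _ "{}"])
  moreover have "range (curve_point b \<alpha>) \<subseteq> points (fubini_study b)"
    using curve_point_in_affine_domain[of b \<alpha>]
    by (auto simp: fubini_study_def affine_domain_def)
  moreover have "p \<in> affine_domain None" if "p \<in> range (curve_point b \<alpha>)" for p
    using that by auto
  ultimately show ?thesis
    unfolding complex_submanifold_def
    by (intro conjI ballI exI[of _ "affine_domain None"] exI[of _ "curve_chart b i0 \<alpha>"]
        exI[of _ "range (axis i0)"] slice_chart_curve[OF assms]) simp_all
qed

text \<open>In the straightened charts \<open>F\<close> is the linear map that puts coordinate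
  \<open>i\<close> on axis \<open>j\<close>. The curves enter symmetrically, so the lemma also
  serves for the inverse.\<close>

lemma holomorphic_map_curves:
  assumes b: "0 < b" "graph_curve i \<alpha> \<alpha>'" and a: "0 < a" "graph_curve j \<beta> \<beta>'"
    and F: "\<And>t. F (curve_point b \<alpha> t) = curve_point a \<beta> t"
  shows "holomorphic_map (fubini_study b) (range (curve_point b \<alpha>))
    (fubini_study a) (range (curve_point a \<beta>)) F"
proof -
  let ?U = "affine_domain None" and ?\<phi> = "curve_chart b i \<alpha>"
  have inj: "inj_on ?\<phi> ?U"
    using curve_chart_in_maximal_atlas[OF b] by (simp add: maximal_atlas_def)
  have inv: "inv_into ?U ?\<phi> (axis i t) = curve_point b \<alpha> t" for t
    using inv_into_f_f[OF inj, of "curve_point b \<alpha> t"]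
    by (simp add: curve_chart_curve_point[OF b])
  have "complex_linear (\<lambda>z. axis j (z $ i))"
    by (rule complex_linearI) (simp_all add: vec_eq_iff axis_def)
  moreover have "((\<lambda>z. axis j (z $ i)) has_derivative (\<lambda>z. axis j (z $ i))) (at z within X)"
    for z :: "complex ^ _" and X
  proof (rule has_derivative_vec)
    fix l
    show "((\<lambda>z. axis j (z $ i) $ l) has_derivative (\<lambda>z. axis j (z $ i) $ l)) (at z within X)"
      by (cases "l = j") (simp_all add: axis_def has_derivative_vec_nth_at)
  qed
  ultimately have "holo_on (\<lambda>z. axis j (z $ i)) (range (axis i))"
    unfolding holo_on_def by blast
  then have "holo_on (curve_chart a j \<beta> \<circ> F \<circ> inv_into ?U ?\<phi>)
      (?\<phi> ` (?U \<inter> range (curve_point b \<alpha>)))"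
    unfolding curve_chart_image[OF b]
    by (rule holo_on_cong[rotated]) (auto simp: inv F curve_chart_curve_point[OF a])
  moreover have "F ` (?U \<inter> range (curve_point b \<alpha>)) \<subseteq> affine_domain None"
    by (auto simp: F)
  ultimately show ?thesis
    unfolding holomorphic_map_def
    by (intro conjI ballI exI[of _ "affine_domain None"] exI[of _ ?\<phi>] exI[of _ "range (axis i)"]
        exI[of _ "curve_chart a j \<beta>"] slice_chart_curve[OF b] curve_chart_in_maximal_atlas[OF a])
      (auto simp: F)
qed

section \<open>The induced metric of a curve in arbitrary charts\<close>

text \<open>The homogeneous expression for the length of the velocity contains no chart index, so
  charts \<open>j\<close> and \<open>None\<close> give the same length.\<close>

lemma curve_velocity_in_affine_chart:
  fixes \<alpha> :: "complex \<Rightarrow> complex ^ 'n::finite"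
  assumes b: "0 < b" and \<alpha>: "graph_curve i0 \<alpha> \<alpha>'" and j: "curve_point b \<alpha> t \<in> affine_domain j"
  obtains v where
    "((\<lambda>s. affine_coords b j (curve_point b \<alpha> s)) has_derivative (\<lambda>h. h *s v)) (at t)"
    "hermitian_form (complex_hessian (fs_potential b) (affine_coords b j (curve_point b \<alpha> t))) v v
      = hermitian_form (complex_hessian (fs_potential b) (\<alpha> t)) (\<alpha>' t) (\<alpha>' t)"
proof -
  define \<zeta> where "\<zeta> s = homog b None (\<alpha> s)" for s
  define \<zeta>' where "\<zeta>' = homog_deriv b None (\<alpha>' t)"
  let ?v = "\<lambda>k. \<chi> i. (\<zeta>' $ slot k i * \<zeta> t $ k - \<zeta> t $ slot k i * \<zeta>' $ k)
      / (complex_of_real (sqrt b) * (\<zeta> t $ k)\<^sup>2)"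
  have j': "\<zeta> t $ j \<noteq> 0"
    using j by (simp add: \<zeta>_def curve_point_in_affine_domain_iff)
  have D: "((\<lambda>s. \<zeta> s $ l) has_field_derivative \<zeta>' $ l) (at t)" for l
  proof (cases l)
    case (Some i)
    have "((\<lambda>s. \<alpha> s $ i) has_field_derivative \<alpha>' t $ i) (at t)"
      using \<alpha> by (simp add: graph_curve_def)
    then show ?thesis
      by (simp add: Some \<zeta>_def \<zeta>'_def homog_def homog_deriv_def DERIV_cmult)
  qed (simp add: \<zeta>_def \<zeta>'_def homog_deriv_def)
  \<comment> \<open>The coordinate formula needs entry \<open>j\<close> to be nonzero, which is
    guaranteed only near \<open>t\<close>.\<close>
  have ev: "\<forall>\<^sub>F s in at t. \<zeta> s $ j \<noteq> 0"
    using D[of j, THEN DERIV_isCont] j' by (simp add: isCont_def tendsto_imp_eventually_ne)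
  have "((\<lambda>s. affine_coords b j (curve_point b \<alpha> s)) has_derivative (\<lambda>h. h *s ?v j)) (at t)"
  proof (rule has_derivative_vec)
    fix i
    have "((\<lambda>s. \<zeta> s $ slot j i / (complex_of_real (sqrt b) * \<zeta> s $ j))
        has_field_derivative ?v j $ i) (at t)"
      using j' b by (auto intro!: derivative_eq_intros D simp: field_simps power2_eq_square)
    moreover have "(\<lambda>h. (h *s v) $ i) = (*) (v $ i)" for v :: "complex ^ 'n"
      by (simp add: fun_eq_iff mult.commute)
    ultimately have "((\<lambda>s. \<zeta> s $ slot j i / (complex_of_real (sqrt b) * \<zeta> s $ j))
        has_derivative (\<lambda>h. (h *s ?v j) $ i)) (at t)"
      by (simp only: has_field_derivative_def)
    then show "((\<lambda>s. affine_coords b j (curve_point b \<alpha> s) $ i)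
        has_derivative (\<lambda>h. (h *s ?v j) $ i)) (at t)"
      by (rule has_derivative_transform_eventually)
        (use ev j' in \<open>auto simp: curve_point_def \<zeta>_def affine_coords_span elim!: eventually_mono\<close>)
  qed
  moreover have "hermitian_form (complex_hessian (fs_potential b)
        (affine_coords b j (curve_point b \<alpha> t))) (?v j) (?v j)
      = hermitian_form (complex_hessian (fs_potential b) (\<alpha> t)) (\<alpha>' t) (\<alpha>' t)"
  proof -
    have 1: "affine_coords b j (curve_point b \<alpha> t)
        = (\<chi> i. \<zeta> t $ slot j i / (complex_of_real (sqrt b) * \<zeta> t $ j))"
      using j' by (simp add: vec_eq_iff curve_point_def \<zeta>_def affine_coords_span)
    have 2: "\<alpha> t = (\<chi> i. \<zeta> t $ slot None i / (complex_of_real (sqrt b) * \<zeta> t $ None))"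
      using b by (simp add: vec_eq_iff \<zeta>_def)
    \<comment> \<open>In chart \<open>None\<close> the normalised entry is constantly 1 with
      derivative 0, so the quotient rule returns the velocity of the given curve.\<close>
    have 3: "\<alpha>' t = ?v None"
      using b by (simp add: vec_eq_iff \<zeta>_def \<zeta>'_def homog_deriv_def slot_def homog_def)
    have 4: "\<zeta> t $ None \<noteq> 0"
      by (simp add: \<zeta>_def)
    show ?thesis
      unfolding 1 2 3 hermitian_form_homogeneous[OF b j'] hermitian_form_homogeneous[OF b 4] ..
  qed
  ultimately show ?thesis
    using that by blast
qed

text \<open>The slice chart is arbitrary, so every coordinate expression is factored through the
  curve parameter; \<open>D\<close> and \<open>D'\<close> then carry the same scalar, and
  \<open>metric\<close> compares the two velocities.\<close>

lemma preserves_induced_metric_curves: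
  fixes \<alpha> :: "complex \<Rightarrow> complex ^ 'n::finite" and \<beta> :: "complex \<Rightarrow> complex ^ 'm::finite"
  assumes b: "0 < b" "graph_curve i \<alpha> \<alpha>'" and a: "0 < a" "graph_curve j \<beta> \<beta>'"
    and F: "\<And>t. F (curve_point b \<alpha> t) = curve_point a \<beta> t"
    and metric: "\<And>t. hermitian_form (complex_hessian (fs_potential b) (\<alpha> t)) (\<alpha>' t) (\<alpha>' t)
      = hermitian_form (complex_hessian (fs_potential a) (\<beta> t)) (\<beta>' t) (\<beta>' t)"
  shows "preserves_induced_metric (fubini_study b) (range (curve_point b \<alpha>)) (fubini_study a) F"
  unfolding preserves_induced_metric_def
proof (intro allI impI ballI)
  fix U \<phi> V W \<psi> W' \<psi>' p D D' v w
  let ?S = "range (curve_point b \<alpha>)"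
  assume sl: "slice_chart (fubini_study b) ?S (U, \<phi>) V"
    and "(W, \<psi>) \<in> atlas (fubini_study b :: 'n fubini_study_space)"
    and "(W', \<psi>') \<in> atlas (fubini_study a :: 'm fubini_study_space)"
    and p: "p \<in> ?S \<inter> U \<inter> W" "F p \<in> W'"
    and D: "(\<psi> \<circ> inv_into U \<phi> has_derivative D) (at (\<phi> p) within \<phi> ` (U \<inter> ?S))"
    and D': "(\<psi>' \<circ> F \<circ> inv_into U \<phi> has_derivative D') (at (\<phi> p) within \<phi> ` (U \<inter> ?S))"
    and vw: "v \<in> V" "w \<in> V"
  then obtain k k' where k: "W = affine_domain k" "\<psi> = affine_coords b k"
      "W' = affine_domain k'" "\<psi>' = affine_coords a k'"
    by (auto simp: fubini_study_def)
  obtain t where t: "p = curve_point b \<alpha> t"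
    using p(1) by blast
  let ?X = "\<phi> ` (U \<inter> ?S)"
  have X: "?X = \<phi> ` U \<inter> V" "vec.subspace V" and mx: "(U, \<phi>) \<in> maximal_atlas (fubini_study b)"
    using sl by (auto simp: slice_chart_def)
  have inj: "inj_on \<phi> U" and op: "open (\<phi> ` U)"
    using mx by (auto simp: maximal_atlas_def)
  have pX: "\<phi> p \<in> ?X" using p by blast
  have inv: "inv_into U \<phi> (\<phi> q) = q" if "q \<in> U" for q
    using that by (rule inv_into_f_f[OF inj])
  \<comment> \<open>The curve parameter as a function of the slice coordinates.\<close>
  define u where "u x = affine_coords b None (inv_into U \<phi> x) $ i" for x
  have u: "inv_into U \<phi> x = curve_point b \<alpha> (u x)" if "x \<in> ?X" for x
    using that b by (auto simp: inv u_def graph_curve_def)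
  have up: "u (\<phi> p) = t"
    using p b by (simp add: u_def inv t graph_curve_def)
  have "holo_on (affine_coords b None \<circ> inv_into U \<phi>) (\<phi> ` (U \<inter> affine_domain None))"
    using mx by (auto simp: maximal_atlas_def fubini_study_def)
  moreover have sub: "?X \<subseteq> \<phi> ` (U \<inter> affine_domain None)"
    by auto
  ultimately obtain E where
    "((affine_coords b None \<circ> inv_into U \<phi>) has_derivative E) (at (\<phi> p) within ?X)"
    using pX unfolding holo_on_def by (meson has_derivative_subset subsetD)
  from has_derivative_vec_nth[OF this, of i]
  have E: "(u has_derivative (\<lambda>h. E h $ i)) (at (\<phi> p) within ?X)"
    by (simp add: u_def[abs_def] o_def)
  have chain: "T y = (E y $ i) *s g"
    if K: "(K has_derivative (\<lambda>h. h *s g)) (at t)"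
      and T: "(f has_derivative T) (at (\<phi> p) within ?X)"
      and f: "\<And>x. x \<in> ?X \<Longrightarrow> f x = K (u x)" and y: "y \<in> V"
    for K :: "complex \<Rightarrow> complex ^ 'q::finite" and g f T y
  proof -
    have "((\<lambda>x. K (u x)) has_derivative (\<lambda>h. (E h $ i) *s g)) (at (\<phi> p) within ?X)"
      by (rule has_derivative_compose[OF E]) (simp add: up K)
    then have "(f has_derivative (\<lambda>h. (E h $ i) *s g)) (at (\<phi> p) within ?X)"
      by (rule has_derivative_transform[OF pX, rotated]) (rule f)
    \<comment> \<open>The two derivatives can be compared only on \<open>V\<close>:
      \<open>?X\<close> is open in \<open>V\<close>, but need not be open in the whole
      space.\<close>
    with T show ?thesis
      using has_derivative_unique_on_subspace[OF op X(2) _ y] pX unfolding X(1) by blast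
  qed
  obtain g where g: "((\<lambda>s. \<psi> (curve_point b \<alpha> s)) has_derivative (\<lambda>h. h *s g)) (at t)"
    "hermitian_form (complex_hessian (fs_potential b) (\<psi> p)) g g
      = hermitian_form (complex_hessian (fs_potential b) (\<alpha> t)) (\<alpha>' t) (\<alpha>' t)"
    using curve_velocity_in_affine_chart[OF b, of t k] p(1) by (auto simp: k t)
  obtain g' where g': "((\<lambda>s. \<psi>' (curve_point a \<beta> s)) has_derivative (\<lambda>h. h *s g')) (at t)"
    "hermitian_form (complex_hessian (fs_potential a) (\<psi>' (F p))) g' g'
      = hermitian_form (complex_hessian (fs_potential a) (\<beta> t)) (\<beta>' t) (\<beta>' t)"
    using curve_velocity_in_affine_chart[OF a, of t k'] p(2) by (auto simp: k t F)
  have Dv: "D y = (E y $ i) *s g" if "y \<in> V" for y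
    by (rule chain[OF g(1) D _ that]) (use u in simp)
  have Dv': "D' y = (E y $ i) *s g'" if "y \<in> V" for y
    by (rule chain[OF g'(1) D' _ that]) (use u F in simp)
  show "hermitian_form (hmetric (fubini_study b) (W, \<psi>) (\<psi> p)) (D v) (D w)
      = hermitian_form (hmetric (fubini_study a) (W', \<psi>') (\<psi>' (F p))) (D' v) (D' w)"
    using g(2) g'(2) metric[of t]
    by (simp add: Dv Dv' vw hermitian_form_rank_one fubini_study_def)
qed

lemma relatives_if_isometric_curves:
  fixes \<alpha> :: "complex \<Rightarrow> complex ^ 'n::finite" and \<beta> :: "complex \<Rightarrow> complex ^ 'm::finite"
  assumes b: "0 < b" "graph_curve i \<alpha> \<alpha>'" and a: "0 < a" "graph_curve j \<beta> \<beta>'"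
    and metric: "\<And>t. hermitian_form (complex_hessian (fs_potential b) (\<alpha> t)) (\<alpha>' t) (\<alpha>' t)
      = hermitian_form (complex_hessian (fs_potential a) (\<beta> t)) (\<beta>' t) (\<beta>' t)"
  shows "relatives (fubini_study b :: 'n fubini_study_space) (fubini_study a :: 'm fubini_study_space)"
proof -
  let ?S = "range (curve_point b \<alpha>)" and ?T = "range (curve_point a \<beta>)"
  define F :: "'n projective_point \<Rightarrow> 'm projective_point"
    where "F L = curve_point a \<beta> (affine_coords b None L $ i)" for L
  have F: "F (curve_point b \<alpha> t) = curve_point a \<beta> t" for t
    using b by (simp add: F_def graph_curve_def)
  have "s = t" if "curve_point a \<beta> s = curve_point a \<beta> t" for s t
    using arg_cong[OF that, of "\<lambda>L. affine_coords a None L $ j"] a by (simp add: graph_curve_def)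
  then have inj: "inj_on F ?S"
    by (auto simp: inj_on_def F)
  then have inv: "inv_into ?S F (curve_point a \<beta> t) = curve_point b \<alpha> t" for t
    using inv_into_f_f[OF inj, of "curve_point b \<alpha> t"] by (simp add: F)
  have "biholomorphic_map (fubini_study b) ?S (fubini_study a) ?T F"
    unfolding biholomorphic_map_def bij_betw_def
    using inj holomorphic_map_curves[OF b a F] holomorphic_map_curves[OF a b inv]
    by (simp add: image_image F)
  then show ?thesis
    unfolding relatives_def
    using complex_submanifold_curve[OF b] complex_submanifold_curve[OF a]
      preserves_induced_metric_curves[OF b a F metric] zero_less_one
    by blast
qed

section \<open>Rational normal curves\<close>

text \<open>Moments of a binomial distribution with success probability \<open>x\<close>: the
  weights are \<open>(1 + y) ^ s\<close> times the Bernstein polynomials at \<open>x\<close>, whose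
  moments are known.\<close>

lemma binomial_moments:
  fixes y :: real
  assumes "0 \<le> y"
  defines "x \<equiv> y / (1 + y)"
  shows "(\<Sum>k\<le>s. real (s choose k) * y ^ k) = (1 + y) ^ s"
    and "(\<Sum>k\<le>s. real k * (real (s choose k) * y ^ k)) = (1 + y) ^ s * (real s * x)"
    and "(\<Sum>k\<le>s. (real k)\<^sup>2 * (real (s choose k) * y ^ k))
      = (1 + y) ^ s * (real s * (real s - 1) * x\<^sup>2 + real s * x)"
proof -
  have B: "real (s choose k) * y ^ k = (1 + y) ^ s * Bernstein s k x" if "k \<le> s" for k
  proof -
    have "1 - x = 1 / (1 + y)"
      using assms(1) by (simp add: x_def field_simps)
    moreover have "(1 + y) ^ s = (1 + y) ^ k * (1 + y) ^ (s - k)"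
      using that by (simp flip: power_add)
    ultimately show ?thesis
      using assms(1) by (simp add: Bernstein_def x_def power_divide)
  qed
  have 1: "(\<Sum>k\<le>s. f k * (real (s choose k) * y ^ k)) = (1 + y) ^ s * (\<Sum>k\<le>s. f k * Bernstein s k x)"
    for f :: "nat \<Rightarrow> real"
    by (simp add: B sum_distrib_left mult.left_commute)
  show "(\<Sum>k\<le>s. real (s choose k) * y ^ k) = (1 + y) ^ s"
    using 1[of "\<lambda>_. 1"] by simp
  show "(\<Sum>k\<le>s. real k * (real (s choose k) * y ^ k)) = (1 + y) ^ s * (real s * x)"
    unfolding 1 by simp
  \<comment> \<open>The known second-order formula is for k (k - 1), so k^2 is split as k (k - 1) +
    k.\<close>
  have "(\<Sum>k\<le>s. (real k)\<^sup>2 * Bernstein s k x)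
      = (\<Sum>k\<le>s. real k * (real k - 1) * Bernstein s k x) + (\<Sum>k\<le>s. real k * Bernstein s k x)"
    unfolding sum.distrib[symmetric] by (simp add: power2_eq_square algebra_simps)
  then show "(\<Sum>k\<le>s. (real k)\<^sup>2 * (real (s choose k) * y ^ k))
      = (1 + y) ^ s * (real s * (real s - 1) * x\<^sup>2 + real s * x)"
    unfolding 1 by simp
qed

text \<open>The embedding of degree \<open>s\<close> of the projective line of curvature parameter \<open>c\<close>. The argument \<open>k\<close>
  numbers the coordinates from 1; those with number above \<open>s\<close> vanish on the curve.\<close>

definition veronese :: "real \<Rightarrow> nat \<Rightarrow> ('n::finite \<Rightarrow> nat) \<Rightarrow> complex \<Rightarrow> complex ^ 'n" where
  "veronese c s k t =
     (\<chi> i. complex_of_real (sqrt (real (s choose k i) * c ^ k i / (real s * c))) * t ^ k i)"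

definition veronese_deriv :: "real \<Rightarrow> nat \<Rightarrow> ('n::finite \<Rightarrow> nat) \<Rightarrow> complex \<Rightarrow> complex ^ 'n" where
  "veronese_deriv c s k t =
     (\<chi> i. complex_of_real (sqrt (real (s choose k i) * c ^ k i / (real s * c)))
       * (of_nat (k i) * t ^ (k i - 1)))"

text \<open>The coefficient numbered 1 is the square root of s c / (s c), so that coordinate is
  exactly \<open>t\<close>.\<close>

lemma graph_curve_veronese:
  assumes "0 < c" "0 < s" "k i0 = 1"
  shows "graph_curve i0 (veronese c s k) (veronese_deriv c s k)"
  using assms by (auto simp: graph_curve_def veronese_def veronese_deriv_def intro!: derivative_eq_intros)

text \<open>The value depends on \<open>c\<close> and \<open>t\<close> alone, so curves of different
  degrees in spaces of different dimensions have the same induced metric.\<close>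

lemma hermitian_form_veronese:
  fixes k :: "'n::finite \<Rightarrow> nat"
  assumes c: "0 < c" and s: "0 < s" "s \<le> CARD('n)" and k: "bij_betw k UNIV {1..CARD('n)}"
  shows "hermitian_form (complex_hessian (fs_potential (real s * c)) (veronese c s k t))
      (veronese_deriv c s k t) (veronese_deriv c s k t)
    = complex_of_real (1 / (1 + c * (norm t)\<^sup>2)\<^sup>2)"
proof -
  define b y x where "b = real s * c" and "y = c * (norm t)\<^sup>2" and "x = y / (1 + y)"
  define \<alpha> \<alpha>' where "\<alpha> = veronese c s k t" and "\<alpha>' = veronese_deriv c s k t"
  define e where "e i = real (s choose k i) * c ^ k i / b" for i
  have b: "0 < b" using c s by (simp add: b_def)
  have y: "0 \<le> y" using c by (simp add: y_def)
  have e: "0 \<le> e i" for i using c b by (simp add: e_def)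
  have \<alpha>: "\<alpha> $ i = complex_of_real (sqrt (e i)) * t ^ k i" for i
    by (simp add: \<alpha>_def veronese_def e_def b_def)
  have \<alpha>': "\<alpha>' $ i = complex_of_real (sqrt (e i)) * (of_nat (k i) * t ^ (k i - 1))" for i
    by (simp add: \<alpha>'_def veronese_deriv_def e_def b_def)
  \<comment> \<open>Numbers start at 1, so term 0 is subtracted; terms above \<open>s\<close>
    vanish, and \<open>s \<le> CARD('n)\<close> ensures that none up to \<open>s\<close> is
    missing.\<close>
  have sum: "(\<Sum>i\<in>UNIV. f (k i)) = (\<Sum>l\<le>s. f l) - f 0" if "\<And>l. s < l \<Longrightarrow> f l = 0" for f :: "nat \<Rightarrow> real"
  proof -
    have "(\<Sum>i\<in>UNIV. f (k i)) = sum f {1..CARD('n)}"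
      by (rule sum.reindex_bij_betw[OF k])
    also have "\<dots> = sum f {1..s}"
      using s that by (intro sum.mono_neutral_right) auto
    also have "\<dots> = sum f ({..s} - {0})"
      by (intro sum.cong) auto
    finally show ?thesis
      by (simp add: sum_diff1)
  qed
  have ec: "b * (e i * (norm t) ^ (2 * k i)) = real (s choose k i) * y ^ k i" for i
    using b by (simp add: e_def y_def power_mult_distrib power_mult)
  have "b * (norm \<alpha>)\<^sup>2 = (\<Sum>i\<in>UNIV. b * (e i * (norm t) ^ (2 * k i)))"
    using e by (simp add: norm_vec_def L2_set_def sum_nonneg \<alpha> norm_mult norm_power
        power_mult_distrib sum_distrib_left power_mult[symmetric] mult.commute[of 2])
  also have "\<dots> = (1 + y) ^ s - 1"
    using sum[of "\<lambda>l. real (s choose l) * y ^ l"] binomial_moments(1)[OF y, of s]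
    by (simp add: ec)
  finally have Q: "1 + b * (norm \<alpha>)\<^sup>2 = (1 + y) ^ s"
    by simp
  have Qpos: "0 < (1 + y) ^ s" using y by simp
  define N P where "N = (\<Sum>i\<in>UNIV. \<alpha>' $ i * cnj (\<alpha>' $ i))" and "P = (\<Sum>i\<in>UNIV. \<alpha>' $ i * cnj (\<alpha> $ i))"
  have P': "(\<Sum>i\<in>UNIV. \<alpha> $ i * cnj (\<alpha>' $ i)) = cnj P"
    by (simp add: P_def mult.commute)
  have h: "hermitian_form (complex_hessian (fs_potential b) \<alpha>) \<alpha>' \<alpha>'
      = N / complex_of_real ((1 + y) ^ s)
        - complex_of_real b * P * cnj P / (complex_of_real ((1 + y) ^ s))\<^sup>2"
    unfolding hermitian_form_fs_potential[OF b] Q P' N_def P_def ..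
  have "hermitian_form (complex_hessian (fs_potential b) \<alpha>) \<alpha>' \<alpha>' = complex_of_real (1 / (1 + y)\<^sup>2)"
  \<comment> \<open>The general computation multiplies by \<open>t\<close> and cancels it at the
    end. At \<open>t = 0\<close> only the linear coordinate has nonzero velocity.\<close>
  proof (cases "t = 0")
    case True
    have k0: "k i \<noteq> 0" for i
      using bij_betwE[OF k] by (metis UNIV_I atLeastAtMost_iff not_one_le_zero)
    then have "\<alpha> = 0"
      by (simp add: vec_eq_iff \<alpha> True)
    then have P0: "P = 0"
      by (simp add: P_def)
    obtain i1 where i1: "k i1 = 1"
      using k by (metis One_nat_def Suc_leI atLeastAtMost_iff bij_betw_iff_bijections order_refl
          zero_less_card_finite)
    have k1: "k i = 1 \<longleftrightarrow> i = i1" for i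
      using k i1 by (metis UNIV_I bij_betw_inv_into_left)
    have "e i1 = 1"
      using c s by (simp add: e_def i1 b_def)
    moreover have "k i - 1 \<noteq> 0" if "i \<noteq> i1" for i
      using k0[of i] k1[of i] that by linarith
    ultimately have "\<alpha>' $ i * cnj (\<alpha>' $ i) = (if i = i1 then 1 else 0)" for i
      unfolding \<alpha>' True by (simp add: i1 power_0_left)
    then have "N = 1"
      by (simp add: N_def)
    then show ?thesis
      by (simp add: h P0 y_def True)
  next
    case False
    then have y0: "0 < y" using c by (simp add: y_def)
    have t': "of_nat (k i) * t ^ (k i - 1) * t = of_nat (k i) * t ^ k i" for i
      by (cases "k i") simp_all
    have tt: "t ^ l * cnj t ^ l = complex_of_real ((norm t) ^ (2 * l))" for l
      by (simp add: power_mult complex_norm_square[symmetric] flip: power_mult_distrib)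
    have ee: "complex_of_real (sqrt (e i)) * complex_of_real (sqrt (e i)) = complex_of_real (e i)" for i
      using e[of i] by (simp flip: of_real_mult)
    \<comment> \<open>Multiplication by \<open>t\<close> weights each coordinate with its degree,
      which turns \<open>P\<close> and \<open>N\<close> into first and second moments.\<close>
    have \<alpha>t: "\<alpha>' $ i * t = of_nat (k i) * \<alpha> $ i" for i
      using t'[of i] by (auto simp: \<alpha> \<alpha>' algebra_simps)
    have \<alpha>\<alpha>: "complex_of_real b * (\<alpha> $ i * cnj (\<alpha> $ i)) = complex_of_real (real (s choose k i) * y ^ k i)" for i
    proof -
      have "\<alpha> $ i * cnj (\<alpha> $ i)
          = (complex_of_real (sqrt (e i)) * complex_of_real (sqrt (e i))) * (t ^ k i * cnj t ^ k i)"
        by (simp add: \<alpha> ac_simps)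
      then show ?thesis
        unfolding ee tt ec[symmetric] by (simp only: of_real_mult)
    qed
    have "complex_of_real b * (P * t) = (\<Sum>i\<in>UNIV. of_nat (k i) * (complex_of_real b * (\<alpha> $ i * cnj (\<alpha> $ i))))"
    proof -
      have "P * t = (\<Sum>i\<in>UNIV. (\<alpha>' $ i * t) * cnj (\<alpha> $ i))"
        unfolding P_def sum_distrib_right by (simp add: ac_simps)
      then show ?thesis
        unfolding \<alpha>t by (simp add: sum_distrib_left ac_simps)
    qed
    also have "\<dots> = complex_of_real (\<Sum>i\<in>UNIV. real (k i) * (real (s choose k i) * y ^ k i))"
      by (simp only: \<alpha>\<alpha> of_real_sum of_real_mult of_real_of_nat_eq)
    also have "(\<Sum>i\<in>UNIV. real (k i) * (real (s choose k i) * y ^ k i)) = (1 + y) ^ s * (real s * x)"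
      using sum[of "\<lambda>l. real l * (real (s choose l) * y ^ l)"] binomial_moments(2)[OF y, of s]
      by (simp add: x_def)
    finally have P: "complex_of_real b * (P * t) = complex_of_real ((1 + y) ^ s * (real s * x))" .
    have "complex_of_real b * (N * (t * cnj t))
        = (\<Sum>i\<in>UNIV. (of_nat (k i))\<^sup>2 * (complex_of_real b * (\<alpha> $ i * cnj (\<alpha> $ i))))"
    proof -
      have "N * (t * cnj t) = (\<Sum>i\<in>UNIV. (\<alpha>' $ i * t) * cnj (\<alpha>' $ i * t))"
        unfolding N_def sum_distrib_right by (simp add: ac_simps)
      then show ?thesis
        unfolding \<alpha>t by (simp add: sum_distrib_left power2_eq_square ac_simps)
    qed
    also have "\<dots> = complex_of_real (\<Sum>i\<in>UNIV. (real (k i))\<^sup>2 * (real (s choose k i) * y ^ k i))"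
      by (simp only: \<alpha>\<alpha> of_real_sum of_real_mult of_real_power of_real_of_nat_eq)
    also have "(\<Sum>i\<in>UNIV. (real (k i))\<^sup>2 * (real (s choose k i) * y ^ k i))
        = (1 + y) ^ s * (real s * (real s - 1) * x\<^sup>2 + real s * x)"
      using sum[of "\<lambda>l. (real l)\<^sup>2 * (real (s choose l) * y ^ l)"] binomial_moments(3)[OF y, of s]
      by (simp add: x_def)
    finally have N: "complex_of_real b * (N * (t * cnj t))
        = complex_of_real ((1 + y) ^ s * (real s * (real s - 1) * x\<^sup>2 + real s * x))" .
    define q where "q = (1 + y) ^ s"
    have q: "q \<noteq> 0" using Qpos unfolding q_def by linarith
    have bt: "complex_of_real b * (t * cnj t) = complex_of_real (real s * y)"
      by (simp add: b_def y_def complex_norm_square[symmetric])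
    have nz: "complex_of_real (real s * y) \<noteq> 0"
      using s y0 by simp
    have "complex_of_real (real s * y)
          * (N / complex_of_real q - complex_of_real b * P * cnj P / (complex_of_real q)\<^sup>2)
        = (complex_of_real b * (N * (t * cnj t))) / complex_of_real q
          - (complex_of_real b * (P * t)) * cnj (complex_of_real b * (P * t)) / (complex_of_real q)\<^sup>2"
      unfolding bt[symmetric] by (simp add: algebra_simps)
    also have "\<dots> = complex_of_real (q * (real s * (real s - 1) * x\<^sup>2 + real s * x) / q
        - (q * (real s * x)) * (q * (real s * x)) / q\<^sup>2)"
      unfolding N P q_def complex_cnj_complex_of_real
      by (simp only: of_real_mult of_real_divide of_real_diff of_real_power)
    \<comment> \<open>Second moment minus squared mean: the binomial variance. Cancelling
      \<open>real s * y\<close> at the end removes the degree.\<close>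
    also have "q * (real s * (real s - 1) * x\<^sup>2 + real s * x) / q
        - (q * (real s * x)) * (q * (real s * x)) / q\<^sup>2 = real s * (x * (1 - x))"
      using q by (simp add: power2_eq_square field_simps)
    also have "x * (1 - x) = y * (1 / (1 + y)\<^sup>2)"
      using y by (simp add: x_def field_simps power2_eq_square)
    finally have "complex_of_real (real s * y)
          * (N / complex_of_real q - complex_of_real b * P * cnj P / (complex_of_real q)\<^sup>2)
        = complex_of_real (real s * y) * complex_of_real (1 / (1 + y)\<^sup>2)"
      by (simp only: of_real_mult mult.assoc)
    then show ?thesis
      unfolding h q_def[symmetric] mult_left_cancel[OF nz] .
  qed
  then show ?thesis
    by (simp add: \<alpha>_def \<alpha>'_def b_def y_def)
qed

section \<open>Bounding the degree by the dimension\<close>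

lemma binomial_ge_linear: "1 + s * m \<le> (s + m) choose s"
proof (induction s)
  case (Suc s)
  \<comment> \<open>This is the second summand of Pascal's rule in the step from \<open>s\<close> to
    \<open>Suc s\<close>; it supplies the additional \<open>m\<close>.\<close>
  have "m \<le> (s + m) choose Suc s" for s
  proof (induction m)
    case (Suc m)
    moreover have "0 < (s + m) choose s"
      by (rule zero_less_binomial) simp
    moreover have "(s + Suc m) choose Suc s = ((s + m) choose s) + ((s + m) choose Suc s)"
      by simp
    ultimately show ?case by linarith
  qed simp
  from this[of s] Suc show ?case
    by simp
qed simp

text \<open>For \<open>s = Suc s'\<close> the linear bound reads
  \<open>1 + m + s' * m \<le> m + n\<close>; cancelling \<open>m\<close> leaves
  \<open>s \<le> 1 + s' * m \<le> n\<close>, as \<open>m\<close> is positive.\<close>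

lemma degree_le_dimension:
  assumes "(s + m) choose s < m + n + 1" "0 < m"
  shows "s \<le> n"
proof (cases s)
  case (Suc s')
  have "1 + s * m \<le> m + n"
    using binomial_ge_linear[of s m] assms(1) by linarith
  moreover have "s' \<le> s' * m"
    using assms(2) by simp
  ultimately show ?thesis
    using Suc by (simp only: mult_Suc)
qed simp

lemma ex_numbering: "\<exists>(k :: 'a::finite \<Rightarrow> nat) i. bij_betw k UNIV {1..CARD('a)} \<and> k i = 1"
proof -
  obtain k :: "'a \<Rightarrow> nat" where k: "bij_betw k UNIV {1..CARD('a)}"
    using finite_same_card_bij[of "UNIV :: 'a set" "{1..CARD('a)}"] by auto
  have "1 \<in> k ` UNIV"
    using k by (simp add: bij_betw_def Suc_le_eq)
  with k show ?thesis by force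
qed

theorem theorem4p1:
  fixes a b :: real and s r :: nat
  assumes "0 < a" and "0 < b" and "0 < s" and "0 < r"
    and "real s * a = real r * b"
    and "CARD('m::finite) + CARD('n::finite) + 1 >
           max ((s + CARD('m)) choose s) ((r + CARD('n)) choose r)"
  shows "relatives (fubini_study b :: 'n fubini_study_space)
                   (fubini_study a :: 'm fubini_study_space)"
proof -
  have s: "s \<le> CARD('n)" and r: "r \<le> CARD('m)"
    using assms(6)
    by (auto intro: degree_le_dimension[of s "CARD('m)"] degree_le_dimension[of r "CARD('n)"])
  define c where "c = b / real s"
  have c: "0 < c" and b: "b = real s * c" and a: "a = real r * c"
    using assms by (simp_all add: c_def field_simps)
  obtain k :: "'n \<Rightarrow> nat" and i where k: "bij_betw k UNIV {1..CARD('n)}" "k i = 1"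
    using ex_numbering by blast
  obtain l :: "'m \<Rightarrow> nat" and j where l: "bij_betw l UNIV {1..CARD('m)}" "l j = 1"
    using ex_numbering by blast
  show ?thesis
    using relatives_if_isometric_curves[OF assms(2) graph_curve_veronese[of c s k i, OF c assms(3) k(2)]
        assms(1) graph_curve_veronese[of c r l j, OF c assms(4) l(2)]]
    by (simp add: b a hermitian_form_veronese[OF c assms(3) s k(1)]
        hermitian_form_veronese[OF c assms(4) r l(1)])
qed

end
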